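(* Let $\mathfrak{C}=\left(\begin{matrix} P_{-1} & \subset & P_0\\ \cup & & \cup\\ Q_{-1} & \subset & Q_0\end{matrix},\tau\right)$ be a commuting square of finite dimensional von Neumann algebras. Assume there exist orthogonal projections $p_1,p_2\in Q_{-1}'\cap P_{-1}$ (i.e. projections with $p_1p_2=0$) and orthogonal projections $q_1,q_2\in Q_{-1}'\cap Q_0$ (i.e. projections with $q_1q_2=0$), that are not in $Q_{-1}$, satisfying $[p_1,q_1]-[p_2,q_2]=0$. For $\lambda\in\mathbb{T}$ (complex numbers of modulus $1$) let $$U(\lambda)=I+(\lambda-1)p_1q_1+(\bar\lambda-1)p_2q_2 .$$ Then $$\mathfrak{C}_\lambda=\left(\begin{matrix} P_{-1} & \subset & P_0\\ \cup & & \cup\\ Q_{-1} & \subset & U(\lambda)^*Q_0U(\lambda)\end{matrix},\tau\right),\qquad \lambda\in\mathbb{T},$$ is a one-parameter family of commuting squares.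
   Context: Commuting square: a square of inclusions of finite dimensional von Neumann algebras $Q_{-1}\subset P_{-1}\subset P_0$, $Q_{-1}\subset Q_0\subset P_0$ together with a faithful positive trace $\tau$ on $P_0$, $\tau(1)=1$, such that $E_{P_{-1}}E_{Q_0}=E_{Q_{-1}}$, where $E_A$ denotes the $\tau$-invariant conditional expectation of $P_0$ onto the subalgebra $A\subset P_0$. Notation: $B'\cap A=\{a\in A: ab=ba\ \forall b\in B\}$ and $[x,y]=xy-yx$; $I$ is the identity of $P_0$.
   Formalization: The conjugation is corrected to U(λ)Q_0U(λ)^* from U(λ)^*Q_0U(λ), since the printed form fails: for P_0=M_2, P_{-1} diagonal, Q_{-1}=C, Q_0=span{I,X}, p_1=E_11, p_2=E_22, q_{1,2}=(I±X)/2, λ=i, U^*XU=diag(1,-1) lies in P_{-1}. *)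

theory Defs
  imports "HOL-Analysis.Analysis" "HOL-Library.FuncSet" "HOL-Library.Nonpos_Ints"
begin

class complex_vector = real_vector +
  fixes scaleC :: "complex \<Rightarrow> 'a \<Rightarrow> 'a" (infixr "*\<^sub>C" 75)
  assumes scaleC_add_right: "c *\<^sub>C (x + y) = c *\<^sub>C x + c *\<^sub>C y"
    and scaleC_add_left: "(c + d) *\<^sub>C x = c *\<^sub>C x + d *\<^sub>C x"
    and scaleC_scaleC: "c *\<^sub>C (d *\<^sub>C x) = (c * d) *\<^sub>C x"
    and scaleC_one: "1 *\<^sub>C x = x"
    and scaleR_scaleC: "r *\<^sub>R x = complex_of_real r *\<^sub>C x"

global_interpretation cvec: vector_space "scaleC :: complex \<Rightarrow> 'a \<Rightarrow> 'a::complex_vector"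
  by unfold_locales (simp_all add: scaleC_add_right scaleC_add_left scaleC_scaleC scaleC_one)

class complex_hilbert = complex_vector + banach +
  fixes cinner :: "'a \<Rightarrow> 'a \<Rightarrow> complex"
  assumes cinner_commute: "cinner x y = cnj (cinner y x)"
    and cinner_add_left: "cinner (x + y) z = cinner x z + cinner y z"
    and cinner_scaleC_left: "cinner (c *\<^sub>C x) y = c * cinner x y"
    and cinner_self: "cinner x x = complex_of_real ((norm x)\<^sup>2)"

text \<open>The algebra \<open>B(H)\<close> of bounded complex-linear operators on a complex Hilbert space;
  its multiplication is composition.\<close>

typedef (overloaded) 'h operator =
  "{f :: 'h::complex_hilbert \<Rightarrow> 'h. bounded_linear f \<and> (\<forall>c x. f (c *\<^sub>C x) = c *\<^sub>C f x)}"
  morphisms op_apply Abs_operator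
  by (rule exI[of _ "\<lambda>x. x"]) simp

lemma operator_eqI: "(\<And>x. op_apply a x = op_apply b x) \<Longrightarrow> a = b"
  by (simp add: op_apply_inject[symmetric] fun_eq_iff)

lemma bounded_linear_op_apply: "bounded_linear (op_apply a)"
  using op_apply[of a] by simp

lemma op_apply_scaleC: "op_apply a (c *\<^sub>C x) = c *\<^sub>C op_apply a x"
  using op_apply[of a] by simp

lemmas op_apply_add = linear_add[OF bounded_linear.linear[OF bounded_linear_op_apply]]

lemma bounded_linear_scaleC: "bounded_linear (\<lambda>x::'h::complex_hilbert. c *\<^sub>C x)"
proof (rule bounded_linear_intro)
  show "c *\<^sub>C (x + y) = c *\<^sub>C x + c *\<^sub>C y" for x y :: 'h
    by (rule scaleC_add_right)
  show "c *\<^sub>C (r *\<^sub>R x) = r *\<^sub>R (c *\<^sub>C x)" for r and x :: 'h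
    by (simp add: scaleR_scaleC scaleC_scaleC mult.commute)
  show "norm (c *\<^sub>C x) \<le> norm x * cmod c" for x :: 'h
  proof -
    have "cinner (c *\<^sub>C x) (c *\<^sub>C x) = c * (cnj c * cinner x x)"
      using cinner_commute[of x "c *\<^sub>C x"] cinner_commute[of x x]
      by (simp add: cinner_scaleC_left)
    then have "complex_of_real ((norm (c *\<^sub>C x))\<^sup>2) = complex_of_real ((cmod c * norm x)\<^sup>2)"
      by (simp add: cinner_self power_mult_distrib complex_norm_square mult.assoc
          del: of_real_power)
    then have "(norm (c *\<^sub>C x))\<^sup>2 = (cmod c * norm x)\<^sup>2"
      by (simp only: of_real_eq_iff)
    then show ?thesis
      by (simp add: mult.commute)
  qed
qed

instantiation operator :: (complex_hilbert) "{ring, monoid_mult, complex_vector}"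
begin

definition "0 = Abs_operator (\<lambda>x. 0)"
definition "1 = Abs_operator (\<lambda>x. x)"
definition "a + b = Abs_operator (\<lambda>x. op_apply a x + op_apply b x)"
definition "- a = Abs_operator (\<lambda>x. - op_apply a x)"
definition "a - b = Abs_operator (\<lambda>x. op_apply a x - op_apply b x)"
definition "a * b = Abs_operator (\<lambda>x. op_apply a (op_apply b x))"
definition "scaleC c a = Abs_operator (\<lambda>x. c *\<^sub>C op_apply a x)"
definition "scaleR r (a :: 'a operator) = complex_of_real r *\<^sub>C a"

lemma op_apply_zero: "op_apply 0 x = 0"
  by (simp add: zero_operator_def Abs_operator_inverse)

lemma op_apply_one: "op_apply 1 x = x"
  by (simp add: one_operator_def Abs_operator_inverse)

lemma op_apply_plus: "op_apply (a + b) x = op_apply a x + op_apply b x"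
  by (simp add: plus_operator_def Abs_operator_inverse bounded_linear_add
      bounded_linear_op_apply op_apply_scaleC scaleC_add_right)

lemma op_apply_uminus: "op_apply (- a) x = - op_apply a x"
  by (simp add: uminus_operator_def Abs_operator_inverse bounded_linear_minus
      bounded_linear_op_apply op_apply_scaleC)

lemma op_apply_minus: "op_apply (a - b) x = op_apply a x - op_apply b x"
  by (simp add: minus_operator_def Abs_operator_inverse bounded_linear_sub
      bounded_linear_op_apply op_apply_scaleC cvec.scale_right_diff_distrib)

lemma op_apply_times: "op_apply (a * b) x = op_apply a (op_apply b x)"
  by (simp add: times_operator_def Abs_operator_inverse op_apply_scaleC
      bounded_linear_compose[OF bounded_linear_op_apply bounded_linear_op_apply])

lemma op_apply_scale: "op_apply (c *\<^sub>C a) x = c *\<^sub>C op_apply a x"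
  by (simp add: scaleC_operator_def Abs_operator_inverse op_apply_scaleC scaleC_scaleC
      mult.commute bounded_linear_compose[OF bounded_linear_scaleC bounded_linear_op_apply])

lemmas op_apply_simps = op_apply_zero op_apply_one op_apply_plus op_apply_uminus
  op_apply_minus op_apply_times op_apply_scale

instance
  by standard
    (auto intro!: operator_eqI simp: op_apply_simps op_apply_add scaleR_operator_def
      scaleC_add_right scaleC_add_left scaleC_scaleC scaleC_one)

end

definition is_adjoint :: "'h::complex_hilbert operator \<Rightarrow> 'h operator \<Rightarrow> bool" where
  "is_adjoint a b \<longleftrightarrow> (\<forall>x y. cinner (op_apply a x) y = cinner x (op_apply b y))"

definition adj :: "'h::complex_hilbert operator \<Rightarrow> 'h operator" where
  "adj a = (THE b. is_adjoint a b)"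

definition commutant :: "'h::complex_hilbert operator set \<Rightarrow> 'h operator set" where
  "commutant B = {a. \<forall>b\<in>B. a * b = b * a}"

text \<open>By the bicommutant theorem, equivalent to being a weakly closed unital *-subalgebra
  of \<open>B(H)\<close>. Closure under adjoints is stated relationally, so that it does not depend on
  the (always true) existence of the adjoint behind the definite description in
  \<^const>\<open>adj\<close>.\<close>

definition von_neumann_algebra :: "'h::complex_hilbert operator set \<Rightarrow> bool" where
  "von_neumann_algebra M \<longleftrightarrow>
     (\<forall>a\<in>M. \<exists>b\<in>M. is_adjoint a b) \<and> commutant (commutant M) = M"

definition finite_dim :: "'a::complex_vector set \<Rightarrow> bool" where
  "finite_dim M \<longleftrightarrow> (\<exists>B. finite B \<and> M = cvec.span B)"

definition projection :: "'h::complex_hilbert operator \<Rightarrow> bool" where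
  "projection p \<longleftrightarrow> adj p = p \<and> p * p = p"

definition clinear_on :: "'a::complex_vector set \<Rightarrow> ('a \<Rightarrow> 'b::ab_group_add) \<Rightarrow>
    (complex \<Rightarrow> 'b \<Rightarrow> 'b) \<Rightarrow> bool" where
  "clinear_on P f s \<longleftrightarrow>
     (\<forall>x\<in>P. \<forall>y\<in>P. f (x + y) = f x + f y) \<and> (\<forall>c. \<forall>x\<in>P. f (c *\<^sub>C x) = s c (f x))"

definition faithful_normalized_trace ::
    "'h::complex_hilbert operator set \<Rightarrow> ('h operator \<Rightarrow> complex) \<Rightarrow> bool" where
  "faithful_normalized_trace P \<tau> \<longleftrightarrow>
     clinear_on P \<tau> (*) \<and>
     (\<forall>x\<in>P. \<forall>y\<in>P. \<tau> (x * y) = \<tau> (y * x)) \<and>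
     (\<forall>x\<in>P. \<tau> (adj x * x) \<in> \<real>\<^sub>\<ge>\<^sub>0) \<and>
     (\<forall>x\<in>P. \<tau> (adj x * x) = 0 \<longrightarrow> x = 0) \<and>
     \<tau> 1 = 1"

definition positive_operator :: "'h::complex_hilbert operator \<Rightarrow> bool" where
  "positive_operator a \<longleftrightarrow> (\<forall>x. cinner (op_apply a x) x \<in> \<real>\<^sub>\<ge>\<^sub>0)"

text \<open>Positivity of \<open>E\<close> is tested on the elements \<open>x\<^sup>* x\<close>, which are precisely the positive
  elements of \<open>P\<close>.\<close>

definition conditional_expectation ::
    "'h::complex_hilbert operator set \<Rightarrow> 'h operator set \<Rightarrow> ('h operator \<Rightarrow> 'h operator) \<Rightarrow> bool"
  where
  "conditional_expectation P A E \<longleftrightarrow>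
     E \<in> P \<rightarrow> A \<and>
     clinear_on P E scaleC \<and>
     (\<forall>a\<in>A. E a = a) \<and>
     (\<forall>a\<in>A. \<forall>b\<in>A. \<forall>x\<in>P. E (a * x * b) = a * E x * b) \<and>
     (\<forall>x\<in>P. positive_operator (E (adj x * x)))"

text \<open>For a von Neumann subalgebra \<open>A\<close> of a finite-dimensional \<open>P\<close> with a faithful trace, the
  trace-invariant conditional expectation exists and is unique as a map on \<open>P\<close>; extensionality
  fixes its values outside \<open>P\<close>.\<close>

definition cond_exp ::
    "'h::complex_hilbert operator set \<Rightarrow> ('h operator \<Rightarrow> complex) \<Rightarrow> 'h operator set \<Rightarrow>
      'h operator \<Rightarrow> 'h operator" where
  "cond_exp P \<tau> A =
     (THE E. E \<in> extensional P \<and> conditional_expectation P A E \<and> (\<forall>x\<in>P. \<tau> (E x) = \<tau> x))"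

text \<open>The arguments are the corners of the square in the order top left, top right, bottom
  left, bottom right: \<open>P1 \<subseteq> P0\<close> above \<open>Q1 \<subseteq> Q0\<close>, where the suffix 1 stands for the index -1.\<close>

definition commuting_square ::
    "'h::complex_hilbert operator set \<Rightarrow> 'h operator set \<Rightarrow> 'h operator set \<Rightarrow> 'h operator set \<Rightarrow>
      ('h operator \<Rightarrow> complex) \<Rightarrow> bool" where
  "commuting_square P1 P0 Q1 Q0 \<tau> \<longleftrightarrow>
     (\<forall>M\<in>{P1, P0, Q1, Q0}. von_neumann_algebra M \<and> finite_dim M) \<and>
     Q1 \<subseteq> P1 \<and> P1 \<subseteq> P0 \<and> Q1 \<subseteq> Q0 \<and> Q0 \<subseteq> P0 \<and>
     faithful_normalized_trace P0 \<tau> \<and>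
     (\<forall>x\<in>P0. cond_exp P0 \<tau> P1 (cond_exp P0 \<tau> Q0 x) = cond_exp P0 \<tau> Q1 x)"

definition commutator :: "'a::ring \<Rightarrow> 'a \<Rightarrow> 'a" where
  "commutator x y = x * y - y * x"

end

(* The relation [p1,q1] = [p2,q2] says that X = p1 q1 + q2 p2 is self-adjoint; hence X equals both
   p1 q1 p1 + p2 q2 p2 and q1 p1 q1 + q2 p2 q2, which makes U(l) unitary.  Since p1 p2 = 0 and
   the expectations of q y, y q and q y q onto Q1 agree for a projection q commuting with Q1,
   expanding gives E_P1(U y U^* ) = E_Q1(y) for y in Q0, because |l-1|^2 + (l-1) + (cnj l-1) = 0.
   The expectations are obtained as orthogonal projections for the trace form; their positivity
   as operators comes from the spectral decomposition inside a finite-dimensional algebra. *)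
theory Submission
  imports Defs "HOL-Computational_Algebra.Fundamental_Theorem_Algebra"
begin

section \<open>Operators and adjoints\<close>

text \<open>\<open>cond_exp\<close> is a definite description, so nothing can be said about it until
  a map with all the demanded properties is known to exist and to be unique. The trace form settles
  everything except positivity, which concerns the vectors of the Hilbert space, whereas \<tau> is
  an abstract functional unrelated to those vectors and the space may be infinite-dimensional. The
  bridge is algebraic: an element of a finite-dimensional algebra is annihilated by a polynomial, so
  the algebra itself contains eigenvectors of left multiplication by it, and these can then be
  applied to a vector. For the rotated algebra N the expectation E_N is never computed: the
  commuting square condition follows from E_P1 mapping N into Q1, by comparing traces against
  Q1.\<close>

lemma cinner_add_right: "cinner x (y + z) = cinner x y + cinner x (z :: 'h::complex_hilbert)"
  by (metis cinner_add_left cinner_commute complex_cnj_add)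

lemma cinner_scaleC_right: "cinner x (c *\<^sub>C y) = cnj c * cinner x (y :: 'h::complex_hilbert)"
  by (metis cinner_commute cinner_scaleC_left complex_cnj_mult)

lemma cinner_zero_left: "cinner 0 (y :: 'h::complex_hilbert) = 0"
  using cinner_add_left[of 0 0 y] by simp

lemma cinner_zero_right: "cinner (y :: 'h::complex_hilbert) 0 = 0"
  using cinner_add_right[of y 0 0] by simp

lemma cinner_diff_right: "cinner x (y - z) = cinner x y - cinner x (z :: 'h::complex_hilbert)"
  using cinner_add_right[of x "y - z" z] by simp

lemma cinner_sum_left:
  "cinner (\<Sum>i\<in>S. f i) (y :: 'h::complex_hilbert) = (\<Sum>i\<in>S. cinner (f i) y)"
  by (induction S rule: infinite_finite_induct) (simp_all add: cinner_add_left cinner_zero_left)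

lemma cinner_sum_right:
  "cinner (y :: 'h::complex_hilbert) (\<Sum>i\<in>S. f i) = (\<Sum>i\<in>S. cinner y (f i))"
  by (induction S rule: infinite_finite_induct) (simp_all add: cinner_add_right cinner_zero_right)

lemma cinner_extensionality:
  assumes "\<And>x. cinner x y = cinner x (z :: 'h::complex_hilbert)"
  shows "y = z"
proof -
  have "cinner (y - z) (y - z) = 0"
    by (simp add: cinner_diff_right assms)
  then show ?thesis by (simp add: cinner_self)
qed

lemma sum_in_nonneg_Reals:
  fixes f :: "'b \<Rightarrow> 'a::real_algebra_1"
  shows "(\<And>i. i \<in> S \<Longrightarrow> f i \<in> \<real>\<^sub>\<ge>\<^sub>0) \<Longrightarrow> (\<Sum>i\<in>S. f i) \<in> \<real>\<^sub>\<ge>\<^sub>0"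
  by (induction S rule: infinite_finite_induct) auto

lemma op_scaleC_mult_left: "(c *\<^sub>C a) * b = c *\<^sub>C (a * (b :: 'h::complex_hilbert operator))"
  by (auto intro!: operator_eqI simp: op_apply_simps)

lemma op_scaleC_mult_right: "a * (c *\<^sub>C b) = c *\<^sub>C (a * (b :: 'h::complex_hilbert operator))"
  by (auto intro!: operator_eqI simp: op_apply_simps op_apply_scaleC)

lemma op_apply_sum: "op_apply (\<Sum>i\<in>S. f i) x = (\<Sum>i\<in>S. op_apply (f i) x)"
  by (induction S rule: infinite_finite_induct) (simp_all add: op_apply_simps)

lemma is_adjoint_unique:
  assumes "is_adjoint a b" "is_adjoint a c"
  shows "b = c"
proof (rule operator_eqI, rule cinner_extensionality)
  fix x y
  show "cinner x (op_apply b y) = cinner x (op_apply c y)"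
    using assms by (metis is_adjoint_def)
qed

text \<open>All computations with \<open>adj\<close> go through the relation
  \<open>is_adjoint\<close>: a candidate satisfying it is the value of the description, and
  membership in a von Neumann algebra supplies the candidate.\<close>

lemma is_adjoint_adj: "is_adjoint a b \<Longrightarrow> adj a = b"
  unfolding adj_def using is_adjoint_unique by blast

lemma is_adjoint_sym: "is_adjoint a b \<Longrightarrow> is_adjoint b a"
  unfolding is_adjoint_def by (metis cinner_commute)

lemma is_adjoint_one: "is_adjoint 1 1"
  by (simp add: is_adjoint_def op_apply_simps)

lemma is_adjoint_add: "is_adjoint a b \<Longrightarrow> is_adjoint c d \<Longrightarrow> is_adjoint (a + c) (b + d)"
  by (simp add: is_adjoint_def op_apply_simps cinner_add_left cinner_add_right)

lemma is_adjoint_scaleC: "is_adjoint a b \<Longrightarrow> is_adjoint (c *\<^sub>C a) (cnj c *\<^sub>C b)"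
  by (simp add: is_adjoint_def op_apply_simps cinner_scaleC_left cinner_scaleC_right)

lemma is_adjoint_mult: "is_adjoint a b \<Longrightarrow> is_adjoint c d \<Longrightarrow> is_adjoint (a * c) (d * b)"
  by (simp add: is_adjoint_def op_apply_simps)

section \<open>Finite-dimensional von Neumann algebras\<close>

text \<open>A von Neumann algebra equals its bicommutant and is therefore itself a commutant; its
  linear structure, products and unit are all inherited from facts about commutants.\<close>

lemma subspace_commutant: "cvec.subspace (commutant N)"
  unfolding cvec.subspace_def commutant_def
  by (simp add: distrib_left distrib_right op_scaleC_mult_left op_scaleC_mult_right)

lemma commutant_mult: "a \<in> commutant N \<Longrightarrow> b \<in> commutant N \<Longrightarrow> a * b \<in> commutant N"
  unfolding commutant_def by (simp add: mult.assoc) (metis mult.assoc)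

lemma one_in_commutant: "1 \<in> commutant N"
  by (simp add: commutant_def)

locale vn_algebra =
  fixes M :: "'h::complex_hilbert operator set"
  assumes vn: "von_neumann_algebra M"
begin

lemma bicommutant: "commutant (commutant M) = M"
  using vn by (simp add: von_neumann_algebra_def)

lemma subspace: "cvec.subspace M"
  using subspace_commutant[of "commutant M"] by (simp add: bicommutant)

lemmas add_mem = cvec.subspace_add[OF subspace]
lemmas diff_mem = cvec.subspace_diff[OF subspace]
lemmas scale_mem = cvec.subspace_scale[OF subspace]
lemmas zero_mem = cvec.subspace_0[OF subspace]

lemma mult_mem: "a \<in> M \<Longrightarrow> b \<in> M \<Longrightarrow> a * b \<in> M"
  using commutant_mult[of a "commutant M" b] by (simp add: bicommutant)

lemma one_mem: "1 \<in> M"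
  using one_in_commutant[of "commutant M"] by (simp add: bicommutant)

lemma power_mem: "a \<in> M \<Longrightarrow> a ^ n \<in> M"
  by (induction n) (simp_all add: one_mem mult_mem)

lemma is_adjoint_mem: "a \<in> M \<Longrightarrow> is_adjoint a (adj a)"
  using vn is_adjoint_adj by (fastforce simp: von_neumann_algebra_def)

lemma adj_mem: "a \<in> M \<Longrightarrow> adj a \<in> M"
  using vn is_adjoint_adj by (fastforce simp: von_neumann_algebra_def)

lemma adj_adj: "a \<in> M \<Longrightarrow> adj (adj a) = a"
  using is_adjoint_adj is_adjoint_mem is_adjoint_sym by blast

lemma adj_mult: "a \<in> M \<Longrightarrow> b \<in> M \<Longrightarrow> adj (a * b) = adj b * adj a"
  using is_adjoint_adj is_adjoint_mem is_adjoint_mult by blast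

lemma adj_add: "a \<in> M \<Longrightarrow> b \<in> M \<Longrightarrow> adj (a + b) = adj a + adj b"
  using is_adjoint_adj is_adjoint_mem is_adjoint_add by blast

lemma adj_scaleC: "a \<in> M \<Longrightarrow> adj (c *\<^sub>C a) = cnj c *\<^sub>C adj a"
  using is_adjoint_adj is_adjoint_mem is_adjoint_scaleC by blast

lemma adj_diff: "a \<in> M \<Longrightarrow> b \<in> M \<Longrightarrow> adj (a - b) = adj a - adj b"
  using adj_add[of "a - b" b] by (simp add: diff_mem algebra_simps)

end

lemma adj_one: "adj 1 = 1"
  by (rule is_adjoint_adj[OF is_adjoint_one])

lemma adj_zero: "adj 0 = 0"
  by (rule is_adjoint_adj)
    (simp add: is_adjoint_def op_apply_simps cinner_zero_left cinner_zero_right)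

section \<open>Polynomials in an operator\<close>

text \<open>Evaluation mixes two types, complex coefficients and a noncommutative ring of operators,
  so it is written out with \<open>scaleC\<close>.\<close>

definition op_poly :: "complex poly \<Rightarrow> 'h::complex_hilbert operator \<Rightarrow> 'h operator" where
  "op_poly p y = (\<Sum>i\<le>degree p. coeff p i *\<^sub>C y ^ i)"

text \<open>Padding with zero coefficients gives several polynomials a common range of summation,
  even where a sum has smaller degree than its summands.\<close>

lemma op_poly_degree_le:
  assumes "degree p \<le> n"
  shows "op_poly p y = (\<Sum>i\<le>n. coeff p i *\<^sub>C y ^ i)"
  unfolding op_poly_def
  by (rule sum.mono_neutral_left) (use assms in \<open>auto simp: coeff_eq_0\<close>)

lemma op_poly_0: "op_poly 0 y = 0"
  by (simp add: op_poly_def)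

lemma op_poly_add: "op_poly (p + q) y = op_poly p y + op_poly q y"
  using op_poly_degree_le[of p "max (degree p) (degree q)" y]
    op_poly_degree_le[of q "max (degree p) (degree q)" y]
    op_poly_degree_le[of "p + q" "max (degree p) (degree q)" y]
  by (simp add: degree_add_le_max scaleC_add_left sum.distrib)

lemma op_poly_sum: "op_poly (\<Sum>i\<in>S. p i) y = (\<Sum>i\<in>S. op_poly (p i) y)"
  by (induction S rule: infinite_finite_induct) (simp_all add: op_poly_0 op_poly_add)

lemma op_poly_smult: "op_poly (smult c p) y = c *\<^sub>C op_poly p y"
  using op_poly_degree_le[of "smult c p" "degree p" y]
  by (simp add: degree_smult_le op_poly_def cvec.scale_sum_right scaleC_scaleC)

lemma op_poly_monom: "op_poly (monom c n) y = c *\<^sub>C y ^ n"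
proof -
  have "op_poly (monom c n) y = (\<Sum>i\<le>n. coeff (monom c n) i *\<^sub>C y ^ i)"
    by (rule op_poly_degree_le) (rule degree_monom_le)
  also have "\<dots> = (\<Sum>i\<le>n. if i = n then c *\<^sub>C y ^ n else 0)"
    by (rule sum.cong) auto
  finally show ?thesis by simp
qed

lemma op_poly_pCons_0: "op_poly (pCons 0 p) y = op_poly p y * y"
proof -
  have "op_poly (pCons 0 p) y = (\<Sum>i\<le>Suc (degree p). coeff (pCons 0 p) i *\<^sub>C y ^ i)"
    by (rule op_poly_degree_le) (simp add: degree_pCons_le)
  also have "\<dots> = (\<Sum>i\<le>degree p. coeff p i *\<^sub>C y ^ Suc i)"
    by (subst sum.atMost_Suc_shift) simp
  also have "\<dots> = op_poly p y * y"
    by (simp only: op_poly_def sum_distrib_right op_scaleC_mult_left power_Suc2)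
  finally show ?thesis .
qed

text \<open>Peels off one root so that its factor acts on \<open>w\<close> first; this is the
  reduction step of the induction on the degree in \<open>eigenvector_decomposition\<close>.\<close>

lemma op_poly_linear_mult:
  "op_poly ([:- r, 1:] * p) y * w = op_poly p y * (y * w - r *\<^sub>C w)"
proof -
  have "[:- r, 1:] * p = pCons 0 p + smult (- r) p"
    by (simp add: mult_pCons_left add.commute)
  then have "op_poly ([:- r, 1:] * p) y = op_poly p y * y + (- r) *\<^sub>C op_poly p y"
    by (simp only: op_poly_add op_poly_pCons_0 op_poly_smult)
  then show ?thesis
    by (simp add: distrib_right left_diff_distrib right_diff_distrib
        op_scaleC_mult_left op_scaleC_mult_right mult.assoc)
qed

text \<open>Infinitely many powers in a finite-dimensional space are dependent. Dependence is a
  property of the set of powers, not of the sequence, so a repetition among the powers is a separate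
  case, with the annihilator X^m - X^n.\<close>

lemma annihilating_poly_exists:
  assumes "finite B" "\<And>n. y ^ n \<in> cvec.span B"
  shows "\<exists>p. p \<noteq> 0 \<and> op_poly p y = 0"
proof (cases "inj (\<lambda>n. y ^ n)")
  case False
  then obtain m n where mn: "m \<noteq> n" "y ^ m = y ^ n"
    unfolding inj_def by blast
  let ?p = "monom 1 m + monom (-1) n :: complex poly"
  have "coeff ?p m = 1" using mn by simp
  then have "?p \<noteq> 0" by (metis coeff_0 zero_neq_one)
  moreover have "op_poly ?p y = 0"
    by (simp add: op_poly_add op_poly_monom mn)
  ultimately show ?thesis by blast
next
  case True
  have "\<not> finite (range (\<lambda>n. y ^ n))"
    using True by (simp add: finite_image_iff)
  then have "cvec.dependent (range (\<lambda>n. y ^ n))"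
    using cvec.independent_span_bound[OF assms(1)] assms(2) by blast
  then obtain t u v where t: "finite t" "t \<subseteq> range (\<lambda>n. y ^ n)"
    "(\<Sum>v\<in>t. u v *\<^sub>C v) = 0" "v \<in> t" "u v \<noteq> 0"
    unfolding cvec.dependent_explicit by blast
  \<comment> \<open>Recovers an exponent for each power in \<open>t\<close>. Since \<open>g\<close>
    is injective on \<open>t\<close>, no other term contributes to the coefficient at
    \<open>g v\<close>, which is therefore \<open>u v\<close> and nonzero.\<close>
  define g where "g = inv (\<lambda>n. y ^ n)"
  have g: "y ^ g w = w" if "w \<in> t" for w
    unfolding g_def using that t(2) by (intro f_inv_into_f) auto
  let ?p = "\<Sum>w\<in>t. monom (u w) (g w)"
  have "coeff ?p (g v) = (\<Sum>w\<in>t. if w = v then u v else 0)"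
    unfolding coeff_sum
  proof (rule sum.cong[OF refl])
    fix w assume "w \<in> t"
    then have "g w = g v \<longleftrightarrow> w = v" using g t(4) by metis
    then show "coeff (monom (u w) (g w)) (g v) = (if w = v then u v else 0)" by auto
  qed
  then have "coeff ?p (g v) = u v"
    using t by simp
  then have "?p \<noteq> 0" using t(5) by (metis coeff_0)
  moreover have "op_poly ?p y = 0"
    using t(3) g by (simp add: op_poly_sum op_poly_monom)
  ultimately show ?thesis by blast
qed

section \<open>Trace-preserving conditional expectations\<close>

locale tracial_algebra = vn_algebra P for P :: "'h::complex_hilbert operator set" +
  fixes \<tau> :: "'h operator \<Rightarrow> complex"
  assumes faithful_normalized_trace: "faithful_normalized_trace P \<tau>"
begin

lemma trace_add: "x \<in> P \<Longrightarrow> y \<in> P \<Longrightarrow> \<tau> (x + y) = \<tau> x + \<tau> y"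
  and trace_scaleC: "x \<in> P \<Longrightarrow> \<tau> (c *\<^sub>C x) = c * \<tau> x"
  and trace_commute: "x \<in> P \<Longrightarrow> y \<in> P \<Longrightarrow> \<tau> (x * y) = \<tau> (y * x)"
  and trace_pos: "x \<in> P \<Longrightarrow> \<tau> (adj x * x) \<in> \<real>\<^sub>\<ge>\<^sub>0"
  and trace_faithful: "x \<in> P \<Longrightarrow> \<tau> (adj x * x) = 0 \<Longrightarrow> x = 0"
  and trace_one: "\<tau> 1 = 1"
  using faithful_normalized_trace
  by (auto simp: faithful_normalized_trace_def clinear_on_def)

lemma trace_0: "\<tau> 0 = 0"
  using trace_scaleC[OF one_mem, of 0] by simp

lemma trace_diff: "x \<in> P \<Longrightarrow> y \<in> P \<Longrightarrow> \<tau> (x - y) = \<tau> x - \<tau> y"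
  using trace_add[of "x - y" y] by (simp add: diff_mem)

text \<open>In the expansion of the nonnegative number \<tau>((1+x)^* (1+x)) the outer terms 1 and
  \<tau>(x^* x) are real, hence so is the sum of the cross terms. This is how compatibility of the
  trace with adjoints is derived from positivity.\<close>

lemma trace_adj_one_plus:
  assumes "x \<in> P"
  shows "Im (\<tau> x + \<tau> (adj x)) = 0"
proof -
  have "adj (1 + x) * (1 + x) = 1 + x + adj x + adj x * x"
    by (simp add: adj_add assms one_mem adj_one algebra_simps)
  then have "\<tau> (adj (1 + x) * (1 + x)) = 1 + (\<tau> x + \<tau> (adj x)) + \<tau> (adj x * x)"
    by (simp add: trace_add trace_one assms one_mem adj_mem add_mem mult_mem)
  moreover have "\<tau> (adj (1 + x) * (1 + x)) \<in> \<real>\<^sub>\<ge>\<^sub>0" "\<tau> (adj x * x) \<in> \<real>\<^sub>\<ge>\<^sub>0"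
    using assms by (auto intro!: trace_pos add_mem one_mem)
  ultimately show ?thesis by (simp add: complex_nonneg_Reals_iff)
qed

lemma trace_adj:
  assumes "x \<in> P"
  shows "\<tau> (adj x) = cnj (\<tau> x)"
proof (rule complex_eqI)
  show "Im (\<tau> (adj x)) = Im (cnj (\<tau> x))"
    using trace_adj_one_plus[OF assms] by simp
  have "Im (\<tau> (\<i> *\<^sub>C x) + \<tau> (adj (\<i> *\<^sub>C x))) = 0"
    using assms by (intro trace_adj_one_plus scale_mem)
  then show "Re (\<tau> (adj x)) = Re (cnj (\<tau> x))"
    by (simp add: adj_scaleC assms adj_mem trace_scaleC del: cvec.scale_minus_left)
qed

text \<open>Test with b = (x - y)^* and use faithfulness. Every identity between expectations below
  is reduced to traces in this way.\<close>

lemma trace_separating: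
  assumes "vn_algebra A" "A \<subseteq> P" "x \<in> A" "y \<in> A" "\<And>b. b \<in> A \<Longrightarrow> \<tau> (b * x) = \<tau> (b * y)"
  shows "x = y"
proof -
  interpret A: vn_algebra A by fact
  let ?d = "x - y"
  have "adj ?d \<in> A" using assms by (intro A.adj_mem A.diff_mem)
  moreover have "\<tau> (adj ?d * ?d) = \<tau> (adj ?d * x) - \<tau> (adj ?d * y)"
    using assms(2-4) \<open>adj ?d \<in> A\<close> unfolding right_diff_distrib
    by (intro trace_diff) (auto intro: mult_mem)
  ultimately have "\<tau> (adj ?d * ?d) = 0" using assms(5) by simp
  then have "?d = 0" using assms by (intro trace_faithful diff_mem) auto
  then show ?thesis by simp
qed

text \<open>Gram-Schmidt for the form \<tau>(b^* x). The induction hypothesis is used twice, for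
  \<open>x\<close> and for the new generator \<open>c\<close>, whose orthogonal part
  \<open>e\<close> gives the next direction.\<close>

lemma orthogonal_projection_span:
  assumes "finite B" "B \<subseteq> P" "x \<in> P"
  shows "\<exists>a\<in>cvec.span B. \<forall>b\<in>cvec.span B. \<tau> (adj b * (x - a)) = 0"
proof -
  have orth: "\<tau> (adj b * u) = 0"
    if "C \<subseteq> P" "u \<in> P" "b \<in> cvec.span C" "\<And>c. c \<in> C \<Longrightarrow> \<tau> (adj c * u) = 0" for b u C
  proof -
    have "b \<in> P \<and> \<tau> (adj b * u) = 0"
      by (rule cvec.span_induct[OF that(3)])
        (use that in \<open>auto simp: cvec.subspace_def zero_mem add_mem scale_mem adj_mem mult_mem
          adj_add adj_scaleC distrib_right op_scaleC_mult_left trace_add trace_scaleC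
          adj_zero trace_0\<close>)
    then show ?thesis by blast
  qed
  have "\<exists>a\<in>cvec.span B. \<forall>b\<in>B. \<tau> (adj b * (x - a)) = 0"
    using assms
  proof (induction B arbitrary: x rule: finite_induct)
    case empty
    then show ?case by auto
  next
    case (insert c B)
    have spanP: "cvec.span B \<subseteq> P"
      using insert.prems by (intro cvec.span_minimal subspace) auto
    have span: "cvec.span B \<subseteq> cvec.span (insert c B)"
      by (intro cvec.span_mono) auto
    obtain a where a: "a \<in> cvec.span B" "\<forall>b\<in>B. \<tau> (adj b * (x - a)) = 0"
      using insert by blast
    obtain d where d: "d \<in> cvec.span B" "\<forall>b\<in>B. \<tau> (adj b * (c - d)) = 0"
      using insert.IH[of c] insert.prems by blast
    define e where "e = c - d"
    \<comment> \<open>The Fourier coefficient of \<open>x - a\<close> along \<open>e\<close>. If the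
      denominator vanishes, division yields 0, and faithfulness forces \<open>e = 0\<close>, so the
      correction term is void.\<close>
    define k where "k = \<tau> (adj e * (x - a)) / \<tau> (adj e * e)"
    define a' where "a' = a + k *\<^sub>C e"
    have mem: "c \<in> P" "a \<in> P" "d \<in> P" "e \<in> P" "x \<in> P" "B \<subseteq> P"
      using insert.prems a(1) d(1) spanP by (auto simp: e_def intro: diff_mem)
    have e_span: "e \<in> cvec.span (insert c B)"
      unfolding e_def using d(1) span by (auto intro: cvec.span_diff cvec.span_base)
    have tr: "\<tau> (adj b * (x - a')) = \<tau> (adj b * (x - a)) - k * \<tau> (adj b * e)" if "b \<in> P" for b
    proof -
      have "adj b * (x - a') = adj b * (x - a) - k *\<^sub>C (adj b * e)"
        by (simp add: a'_def algebra_simps op_scaleC_mult_right)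
      then show ?thesis
        using that mem
        by (simp add: trace_diff trace_scaleC diff_mem mult_mem adj_mem scale_mem)
    qed
    have orthB: "\<tau> (adj b * (x - a')) = 0" if "b \<in> B" for b
      using tr[of b] a(2) d(2) that mem by (auto simp: e_def)
    have x': "x - a' \<in> P"
      using mem by (simp add: a'_def diff_mem add_mem scale_mem)
    have "\<tau> (adj e * (x - a')) = 0"
    proof (cases "\<tau> (adj e * e) = 0")
      case True
      then have "e = 0" using mem trace_faithful by blast
      then show ?thesis using tr[of e] mem
        by (simp add: adj_zero trace_0)
    next
      case False
      then show ?thesis using tr[of e] mem by (simp add: k_def)
    qed
    \<comment> \<open>Orthogonality to \<open>d\<close> and to \<open>e\<close> together gives
      orthogonality to the generator c = e + d.\<close>
    moreover have "\<tau> (adj d * (x - a')) = 0"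
      by (rule orth[OF mem(6) x' d(1) orthB])
    ultimately have "\<tau> (adj c * (x - a')) = 0"
      using trace_add[of "adj e * (x - a')" "adj d * (x - a')"] mem x'
      by (simp add: e_def adj_diff mult_mem adj_mem diff_mem flip: distrib_right)
    moreover have "a' \<in> cvec.span (insert c B)"
      unfolding a'_def using a(1) span e_span by (auto intro: cvec.span_add cvec.span_scale)
    ultimately show ?case using orthB by auto
  qed
  then obtain a where a: "a \<in> cvec.span B" "\<forall>b\<in>B. \<tau> (adj b * (x - a)) = 0" by blast
  have "cvec.span B \<subseteq> P"
    using assms(2) subspace by (intro cvec.span_minimal)
  then have "x - a \<in> P" using a(1) assms(3) by (intro diff_mem) auto
  then show ?thesis using a orth[OF assms(2)] by blast
qed

end

section \<open>Subalgebras, and operator positivity deduced from the trace\<close>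

locale tracial_subalgebra = tracial_algebra P \<tau> + A: vn_algebra A
  for P :: "'h::complex_hilbert operator set" and \<tau> A +
  assumes subset: "A \<subseteq> P" and finite_dim: "finite_dim A"
begin

text \<open>Eigenvalues of a trace-positive \<open>y\<close> are nonnegative, which also excludes nontrivial Jordan
  blocks; so splitting an annihilating polynomial of \<open>y\<close> into linear factors decomposes
  every element of \<open>A\<close> into eigenvectors for left multiplication by \<open>y\<close>.\<close>

context
  fixes y
  assumes y: "y \<in> A" "adj y = y"
    and trace_positive: "\<And>a. a \<in> A \<Longrightarrow> \<tau> (adj a * (y * a)) \<in> \<real>\<^sub>\<ge>\<^sub>0"
begin

lemma eigenvalue_nonneg:
  assumes "w \<in> A" "y * w = r *\<^sub>C w"
  shows "w = 0 \<or> r \<in> \<real>\<^sub>\<ge>\<^sub>0"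
proof (cases "\<tau> (adj w * w) = 0")
  case True
  then show ?thesis using trace_faithful assms(1) subset by auto
next
  case False
  have "w \<in> P" using assms(1) subset by auto
  then have "\<tau> (adj w * (y * w)) = r * \<tau> (adj w * w)"
    by (simp add: assms(2) op_scaleC_mult_right trace_scaleC mult_mem adj_mem)
  then have "r = \<tau> (adj w * (y * w)) / \<tau> (adj w * w)"
    using False by simp
  then show ?thesis
    using trace_positive[OF assms(1)] trace_pos[OF \<open>w \<in> P\<close>] by (simp add: nonneg_Reals_divide_I)
qed

text \<open>Put q = (y - r) v. If q is nonzero, it is an eigenvector, so r is real and y - r is
  self-adjoint; then q^* q = v^* (y - r) q = 0, contradicting faithfulness.\<close>

lemma generalized_eigenvector:
  assumes "v \<in> A" "y * (y * v - r *\<^sub>C v) = r *\<^sub>C (y * v - r *\<^sub>C v)"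
  shows "y * v = r *\<^sub>C v"
proof (rule ccontr)
  define q where "q = y * v - r *\<^sub>C v"
  assume "y * v \<noteq> r *\<^sub>C v"
  then have "q \<noteq> 0" by (simp add: q_def)
  have "q \<in> A" unfolding q_def using assms(1) y by (intro A.diff_mem A.mult_mem A.scale_mem)
  then have "r \<in> \<real>\<^sub>\<ge>\<^sub>0" using eigenvalue_nonneg[of q r] assms(2) \<open>q \<noteq> 0\<close> by (simp add: q_def)
  then have "cnj r = r" by (simp add: complex_nonneg_Reals_iff complex_eq_iff)
  then have "adj q = adj v * y - r *\<^sub>C adj v"
    unfolding q_def using assms(1) y
    by (simp add: A.adj_diff A.adj_mult A.adj_scaleC A.mult_mem A.scale_mem)
  then have "adj q * q = adj v * (y * q - r *\<^sub>C q)"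
    by (simp add: left_diff_distrib right_diff_distrib op_scaleC_mult_left op_scaleC_mult_right
        mult.assoc)
  also have "\<dots> = 0" using assms(2) by (simp add: q_def)
  finally show False
    using trace_faithful[of q] \<open>q \<in> A\<close> \<open>q \<noteq> 0\<close> subset trace_0 by auto
qed

lemma eigenvector_decomposition:
  assumes "p \<noteq> 0" "v \<in> A" "op_poly p y * v = 0"
  shows "\<exists>S z. finite S \<and> v = (\<Sum>r\<in>S. z r) \<and> (\<forall>r\<in>S. z r \<in> A \<and> y * z r = r *\<^sub>C z r)"
  using assms
proof (induction "degree p" arbitrary: p v)
  case 0
  then obtain c where "p = monom c 0" "c \<noteq> 0"
    by (metis degree_eq_zeroE monom_0 pCons_eq_0_iff)
  then have "v = 0"
    using 0 by (simp add: op_poly_monom op_scaleC_mult_left)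
  then show ?case by (intro exI[of _ "{}"]) auto
next
  case (Suc n)
  then have "\<not> constant (poly p)" by (simp add: constant_degree)
  then obtain r where "poly p r = 0" using fundamental_theorem_of_algebra by blast
  then obtain g where p: "p = [:- r, 1:] * g" by (auto simp: poly_eq_0_iff_dvd)
  have g: "g \<noteq> 0" using Suc.prems p by auto
  then have "n = degree g" using Suc.hyps(2) unfolding p by (subst (asm) degree_mult_eq) auto
  define w where "w = y * v - r *\<^sub>C v"
  have "w \<in> A" unfolding w_def using Suc.prems y by (intro A.diff_mem A.mult_mem A.scale_mem)
  moreover have "op_poly g y * w = 0"
    using Suc.prems(3) unfolding p op_poly_linear_mult w_def .
  ultimately obtain S z where S: "finite S" "w = (\<Sum>s\<in>S. z s)"
    "\<And>s. s \<in> S \<Longrightarrow> z s \<in> A \<and> y * z s = s *\<^sub>C z s"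
    using Suc.hyps(1)[OF \<open>n = degree g\<close> g] by metis
  define T where "T = S - {r}"
  \<comment> \<open>On \<open>z s\<close> the operator y - r acts as s - r, so dividing by s - r
    solves (y - r) u = w up to the component at \<open>r\<close>, the only one that cannot be
    inverted and hence left out of \<open>T\<close>. The remainder v - u is killed by (y - r)^2, and
    so is an eigenvector.\<close>
  define z' where "z' s = (1 / (s - r)) *\<^sub>C z s" for s
  define u where "u = (\<Sum>s\<in>T. z' s)"
  define q where "q = y * (v - u) - r *\<^sub>C (v - u)"
  have z': "z' s \<in> A" "y * z' s = s *\<^sub>C z' s" if "s \<in> T" for s
    using S(3)[of s] that
    by (auto simp: T_def z'_def A.scale_mem op_scaleC_mult_right scaleC_scaleC mult.commute)
  have u: "u \<in> A" unfolding u_def by (intro cvec.subspace_sum A.subspace z')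
  have vu: "v - u \<in> A" using u Suc.prems by (intro A.diff_mem)
  have "y * u - r *\<^sub>C u = (\<Sum>s\<in>T. y * z' s - r *\<^sub>C z' s)"
    by (simp add: u_def sum_distrib_left cvec.scale_sum_right sum_subtractf)
  also have "\<dots> = (\<Sum>s\<in>T. z s)"
  proof (rule sum.cong[OF refl])
    fix s assume s: "s \<in> T"
    then have "y * z' s - r *\<^sub>C z' s = (s - r) *\<^sub>C z' s"
      by (simp add: z' cvec.scale_left_diff_distrib)
    then show "y * z' s - r *\<^sub>C z' s = z s"
      using s by (simp add: z'_def T_def scaleC_scaleC scaleC_one)
  qed
  finally have "q = (\<Sum>s\<in>S. z s) - (\<Sum>s\<in>T. z s)"
    unfolding q_def S(2)[symmetric] w_def by (simp add: algebra_simps cvec.scale_right_diff_distrib)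
  then have "q = (if r \<in> S then z r else 0)"
    using S(1) by (auto simp: T_def sum_diff1)
  then have "y * q = r *\<^sub>C q" using S(3)[of r] by auto
  then have eig: "y * (v - u) = r *\<^sub>C (v - u)"
    using generalized_eigenvector[OF vu] by (simp add: q_def)
  define z'' where "z'' = z'(r := v - u)"
  have "r \<notin> T" "finite T" using S(1) by (auto simp: T_def)
  moreover have "(\<Sum>s\<in>T. z'' s) = u"
    unfolding u_def z''_def using \<open>r \<notin> T\<close> by (intro sum.cong) auto
  ultimately have "v = (\<Sum>s\<in>insert r T. z'' s)"
    by (simp add: z''_def)
  moreover have "\<forall>s\<in>insert r T. z'' s \<in> A \<and> y * z'' s = s *\<^sub>C z'' s"
    using eig vu z' by (auto simp: z''_def)
  ultimately show ?case using \<open>finite T\<close> by (intro exI[of _ "insert r T"]) auto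
qed

text \<open>Decompose the unit into eigenvectors \<open>z r\<close> of left multiplication by
  \<open>y\<close>; then any vector h is the sum of the z_r h, which are genuine eigenvectors of the
  operator \<open>y\<close>, with nonnegative eigenvalues where nonzero and mutually orthogonal
  because \<open>y\<close> is self-adjoint. The quadratic form becomes a sum of r |z_r h|^2.\<close>

lemma positive_operator_if_trace_positive: "positive_operator y"
  unfolding positive_operator_def
proof
  fix h
  obtain B where "finite B" "A = cvec.span B"
    using finite_dim by (auto simp: finite_dim_def)
  then obtain p where "p \<noteq> 0" "op_poly p y = 0"
    using annihilating_poly_exists[of B y] A.power_mem y by blast
  then obtain S z where S: "finite S" "1 = (\<Sum>r\<in>S. z r)"
    "\<And>r. r \<in> S \<Longrightarrow> z r \<in> A \<and> y * z r = r *\<^sub>C z r"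
    using eigenvector_decomposition[of p 1] A.one_mem by (metis (no_types, lifting) mult_zero_left)
  define Z where "Z r = op_apply (z r) h" for r
  have yZ: "op_apply y (Z r) = r *\<^sub>C Z r" if "r \<in> S" for r
    using S(3)[OF that] by (simp add: Z_def flip: op_apply_times op_apply_scale)
  have h: "h = (\<Sum>r\<in>S. Z r)"
    unfolding Z_def op_apply_sum[symmetric] S(2)[symmetric] by (simp add: op_apply_one)
  have "op_apply y h = (\<Sum>r\<in>S. op_apply (y * z r) h)"
    unfolding op_apply_sum[symmetric] sum_distrib_left[symmetric] S(2)[symmetric] by simp
  also have "\<dots> = (\<Sum>r\<in>S. r *\<^sub>C Z r)"
    using S(3) by (intro sum.cong) (simp_all add: Z_def op_apply_scale)
  finally have yh: "op_apply y h = (\<Sum>r\<in>S. r *\<^sub>C Z r)" .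
  have nonneg: "Z r = 0 \<or> r \<in> \<real>\<^sub>\<ge>\<^sub>0" if "r \<in> S" for r
    using eigenvalue_nonneg[of "z r" r] S(3)[OF that] by (auto simp: Z_def op_apply_zero)
  have orth: "cinner (Z r) (Z s) = 0" if "r \<in> S" "s \<in> S" "r \<noteq> s" for r s
  proof (cases "Z s = 0")
    case False
    then have "cnj s = s"
      using nonneg[OF that(2)] by (simp add: complex_nonneg_Reals_iff complex_eq_iff)
    moreover have "cinner (op_apply y (Z r)) (Z s) = cinner (Z r) (op_apply y (Z s))"
      using A.is_adjoint_mem[OF y(1)] y(2) by (simp add: is_adjoint_def)
    ultimately have "r * cinner (Z r) (Z s) = s * cinner (Z r) (Z s)"
      by (simp add: yZ that cinner_scaleC_left cinner_scaleC_right)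
    then show ?thesis using that(3) by simp
  qed (simp add: cinner_zero_right)
  have "cinner (op_apply y h) h = (\<Sum>r\<in>S. \<Sum>s\<in>S. r * cinner (Z r) (Z s))"
    by (subst yh, subst h)
      (simp add: cinner_sum_left cinner_sum_right cinner_scaleC_left sum_distrib_left,
        rule sum.swap)
  also have "\<dots> = (\<Sum>r\<in>S. \<Sum>s\<in>S. if s = r then r * cinner (Z r) (Z r) else 0)"
    by (intro sum.cong refl) (auto simp: orth)
  also have "\<dots> = (\<Sum>r\<in>S. r * cinner (Z r) (Z r))"
    using S(1) by simp
  also have "\<dots> \<in> \<real>\<^sub>\<ge>\<^sub>0"
  proof (rule sum_in_nonneg_Reals)
    fix r assume "r \<in> S"
    then show "r * cinner (Z r) (Z r) \<in> \<real>\<^sub>\<ge>\<^sub>0"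
      using nonneg[of r] by (cases "Z r = 0") (simp_all add: cinner_self cinner_zero_left)
  qed
  finally show "cinner (op_apply y h) h \<in> \<real>\<^sub>\<ge>\<^sub>0" .
qed

end

section \<open>Existence, uniqueness and rules of the trace-preserving expectation\<close>

lemma projection_exists:
  assumes "x \<in> P"
  shows "\<exists>a\<in>A. \<forall>b\<in>A. \<tau> (b * a) = \<tau> (b * x)"
proof -
  obtain B where B: "finite B" "A = cvec.span B"
    using finite_dim by (auto simp: finite_dim_def)
  then have "B \<subseteq> P" using subset cvec.span_superset by blast
  then obtain a where a: "a \<in> A" "\<forall>b\<in>A. \<tau> (adj b * (x - a)) = 0"
    using orthogonal_projection_span[OF B(1) _ assms] B(2) by blast
  have "\<tau> (b * a) = \<tau> (b * x)" if "b \<in> A" for b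
  proof -
    have "\<tau> (b * (x - a)) = 0"
      using a(2) A.adj_mem[OF that] A.adj_adj[OF that] by metis
    moreover have "b \<in> P" "a \<in> P" using that a(1) subset by auto
    ultimately show ?thesis
      using assms by (simp add: right_diff_distrib trace_diff mult_mem)
  qed
  then show ?thesis using a(1) by blast
qed

lemma conditional_expectation_trace:
  assumes "conditional_expectation P A E" "\<forall>x\<in>P. \<tau> (E x) = \<tau> x" "x \<in> P" "b \<in> A"
  shows "\<tau> (b * E x) = \<tau> (b * x)"
proof -
  have "E (b * x * 1) = b * E x * 1"
    using assms A.one_mem unfolding conditional_expectation_def by blast
  then have "E (b * x) = b * E x" by simp
  moreover have "b * x \<in> P" using assms subset by (auto intro: mult_mem)
  ultimately show ?thesis using assms(2) by metis
qed

text \<open>\<open>F\<close> is chosen only by its traces against \<open>A\<close>. By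
  \<open>F_eqI\<close> these traces determine it, so linearity, the bimodule rule and compatibility
  with adjoints are each a computation of traces.\<close>

lemma conditional_expectation_exists:
  "\<exists>E. E \<in> extensional P \<and> conditional_expectation P A E \<and> (\<forall>x\<in>P. \<tau> (E x) = \<tau> x)"
proof -
  obtain F where F: "\<And>x. x \<in> P \<Longrightarrow> F x \<in> A"
    "\<And>x b. x \<in> P \<Longrightarrow> b \<in> A \<Longrightarrow> \<tau> (b * F x) = \<tau> (b * x)"
    using projection_exists by metis
  have FP: "F x \<in> P" if "x \<in> P" for x using F(1)[OF that] subset by auto
  have AP: "a \<in> P" if "a \<in> A" for a using that subset by auto
  note mem = mult_mem add_mem scale_mem adj_mem AP FP
  have F_eqI: "F x = a" if "x \<in> P" "a \<in> A" "\<And>b. b \<in> A \<Longrightarrow> \<tau> (b * x) = \<tau> (b * a)" for x a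
    by (rule trace_separating[OF A.vn_algebra_axioms subset]) (use F that in auto)
  have F_add: "F (x + y) = F x + F y" if "x \<in> P" "y \<in> P" for x y
    by (rule F_eqI) (use that F in \<open>auto simp: distrib_left trace_add mem intro: A.add_mem\<close>)
  have F_scale: "F (c *\<^sub>C x) = c *\<^sub>C F x" if "x \<in> P" for c x
    by (rule F_eqI)
      (use that F in \<open>auto simp: op_scaleC_mult_right trace_scaleC mem intro: A.scale_mem\<close>)
  have F_id: "F a = a" if "a \<in> A" for a
    by (rule F_eqI) (use that in \<open>auto simp: mem\<close>)
  \<comment> \<open>The defining identity of \<open>F\<close> only sees multiplication from the
    left; the trace property rotates the right factor \<open>b\<close> to the front, where b c a
    lies in \<open>A\<close>.\<close>
  have F_bimodule: "F (a * x * b) = a * F x * b" if "a \<in> A" "b \<in> A" "x \<in> P" for a b x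
  proof (rule F_eqI)
    fix c assume c: "c \<in> A"
    have "\<tau> (c * (a * x * b)) = \<tau> (b * c * a * x)"
      using trace_commute[of "c * a * x" b] c that by (simp add: mem mult.assoc)
    also have "\<dots> = \<tau> (b * c * a * F x)"
      using F(2)[of x "b * c * a"] c that by (simp add: A.mult_mem)
    also have "\<dots> = \<tau> (c * (a * F x * b))"
      using trace_commute[of "c * a * F x" b] c that by (simp add: mem mult.assoc)
    finally show "\<tau> (c * (a * x * b)) = \<tau> (c * (a * F x * b))" .
  qed (use that F in \<open>auto intro!: mult_mem A.mult_mem intro: AP\<close>)
  have F_adj: "F (adj x) = adj (F x)" if "x \<in> P" for x
  proof (rule F_eqI)
    fix b assume b: "b \<in> A"
    have "\<tau> (b * adj x) = cnj (\<tau> (x * adj b))"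
      using b that by (simp add: adj_adj adj_mult mem flip: trace_adj)
    also have "\<dots> = cnj (\<tau> (F x * adj b))"
      using F(2)[of x "adj b"] b that by (simp add: A.adj_mem mem trace_commute[of _ "adj b"])
    also have "\<dots> = \<tau> (b * adj (F x))"
      using b that by (simp add: adj_adj adj_mult mem flip: trace_adj)
    finally show "\<tau> (b * adj x) = \<tau> (b * adj (F x))" .
  qed (use that F in \<open>auto simp: mem A.adj_mem\<close>)
  have F_pos: "positive_operator (F (adj x * x))" if x: "x \<in> P" for x
  proof (rule positive_operator_if_trace_positive)
    show "F (adj x * x) \<in> A" using x by (intro F) (simp add: mem)
    show "adj (F (adj x * x)) = F (adj x * x)"
      using x F_adj[of "adj x * x"] by (simp add: mem adj_mult adj_adj)
    fix a assume a: "a \<in> A"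
    \<comment> \<open>Rotating \<open>a\<close> to the front and back again replaces F(x^* x) by x^*
      x between a^* and a, leaving the trace of (x a)^* (x a).\<close>
    have "\<tau> (adj a * (F (adj x * x) * a)) = \<tau> (a * adj a * F (adj x * x))"
      using trace_commute[of "adj a * F (adj x * x)" a] a x by (simp add: mem mult.assoc)
    also have "\<dots> = \<tau> (a * adj a * (adj x * x))"
      using a x by (intro F) (auto intro: mem A.mult_mem A.adj_mem)
    also have "\<dots> = \<tau> (adj (x * a) * (x * a))"
      using trace_commute[of "adj a * (adj x * x)" a] a x by (simp add: mem adj_mult mult.assoc)
    also have "\<dots> \<in> \<real>\<^sub>\<ge>\<^sub>0" using AP[OF a] x by (intro trace_pos mult_mem)
    finally show "\<tau> (adj a * (F (adj x * x) * a)) \<in> \<real>\<^sub>\<ge>\<^sub>0" .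
  qed
  have "conditional_expectation P A (restrict F P)"
    unfolding conditional_expectation_def clinear_on_def
    using F(1) F_add F_scale F_id F_bimodule F_pos by (auto simp: mem)
  moreover have "\<tau> (restrict F P x) = \<tau> x" if "x \<in> P" for x
    using F(2)[OF that A.one_mem] that by simp
  ultimately show ?thesis by (intro exI[of _ "restrict F P"]) auto
qed

text \<open>The bimodule rule and invariance fix all traces of E(x) against \<open>A\<close>, so two
  candidates agree on \<open>P\<close>, and extensionality makes them equal as functions.\<close>

lemma conditional_expectation_cond_exp: "conditional_expectation P A (cond_exp P \<tau> A)"
  and trace_cond_exp: "x \<in> P \<Longrightarrow> \<tau> (cond_exp P \<tau> A x) = \<tau> x"
proof -
  let ?Q = "\<lambda>E. E \<in> extensional P \<and> conditional_expectation P A E \<and> (\<forall>x\<in>P. \<tau> (E x) = \<tau> x)"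
  have "\<exists>!E. ?Q E"
  proof (rule ex_ex1I[OF conditional_expectation_exists])
    fix E F assume E: "?Q E" and F: "?Q F"
    show "E = F"
    proof (rule extensionalityI[of _ P])
      fix x assume x: "x \<in> P"
      show "E x = F x"
      proof (rule trace_separating[OF A.vn_algebra_axioms subset])
        show "E x \<in> A" "F x \<in> A"
          using E F x by (auto simp: conditional_expectation_def)
        show "\<tau> (b * E x) = \<tau> (b * F x)" if "b \<in> A" for b
          using E F x that by (simp add: conditional_expectation_trace)
      qed
    qed (use E F in auto)
  qed
  then have "?Q (cond_exp P \<tau> A)" unfolding cond_exp_def by (rule theI')
  then show "conditional_expectation P A (cond_exp P \<tau> A)"
    and "x \<in> P \<Longrightarrow> \<tau> (cond_exp P \<tau> A x) = \<tau> x" by auto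
qed

lemma cond_exp_mem: "x \<in> P \<Longrightarrow> cond_exp P \<tau> A x \<in> A"
  and cond_exp_add: "x \<in> P \<Longrightarrow> y \<in> P \<Longrightarrow>
    cond_exp P \<tau> A (x + y) = cond_exp P \<tau> A x + cond_exp P \<tau> A y"
  and cond_exp_scaleC: "x \<in> P \<Longrightarrow> cond_exp P \<tau> A (c *\<^sub>C x) = c *\<^sub>C cond_exp P \<tau> A x"
  and cond_exp_id: "a \<in> A \<Longrightarrow> cond_exp P \<tau> A a = a"
  and cond_exp_bimodule: "a \<in> A \<Longrightarrow> b \<in> A \<Longrightarrow> x \<in> P \<Longrightarrow>
    cond_exp P \<tau> A (a * x * b) = a * cond_exp P \<tau> A x * b"
  using conditional_expectation_cond_exp
  by (auto simp: conditional_expectation_def clinear_on_def)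

lemma cond_exp_left: "a \<in> A \<Longrightarrow> x \<in> P \<Longrightarrow> cond_exp P \<tau> A (a * x) = a * cond_exp P \<tau> A x"
  using cond_exp_bimodule[of a 1 x] A.one_mem by simp

lemma cond_exp_right: "a \<in> A \<Longrightarrow> x \<in> P \<Longrightarrow> cond_exp P \<tau> A (x * a) = cond_exp P \<tau> A x * a"
  using cond_exp_bimodule[of 1 a x] A.one_mem by simp

lemma trace_mult_cond_exp: "b \<in> A \<Longrightarrow> x \<in> P \<Longrightarrow> \<tau> (b * cond_exp P \<tau> A x) = \<tau> (b * x)"
  using conditional_expectation_trace conditional_expectation_cond_exp trace_cond_exp by blast

lemma cond_exp_eqI:
  assumes "x \<in> P" "a \<in> A" "\<And>b. b \<in> A \<Longrightarrow> \<tau> (b * x) = \<tau> (b * a)"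
  shows "cond_exp P \<tau> A x = a"
  by (rule trace_separating[OF A.vn_algebra_axioms subset])
    (use assms in \<open>auto simp: cond_exp_mem trace_mult_cond_exp\<close>)

text \<open>For b in \<open>A\<close>, \<tau>(b q x) = \<tau>(q b x) = \<tau>(b x q): first
  commutation of q with b, then the trace property.\<close>

lemma cond_exp_commutant:
  assumes "q \<in> commutant A" "q \<in> P" "x \<in> P"
  shows "cond_exp P \<tau> A (q * x) = cond_exp P \<tau> A (x * q)"
proof (rule cond_exp_eqI)
  fix b assume b: "b \<in> A"
  have bP: "b \<in> P" using b subset by auto
  have "\<tau> (b * (q * x)) = \<tau> (q * (b * x))"
    using assms(1) b by (simp add: commutant_def flip: mult.assoc)
  also have "\<dots> = \<tau> (b * (x * q))"
    using trace_commute[of q "b * x"] assms bP by (simp add: mult_mem mult.assoc)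
  also have "\<dots> = \<tau> (b * cond_exp P \<tau> A (x * q))"
    using assms b by (simp add: trace_mult_cond_exp mult_mem)
  finally show "\<tau> (b * (q * x)) = \<tau> (b * cond_exp P \<tau> A (x * q))" .
qed (use assms in \<open>auto simp: mult_mem cond_exp_mem\<close>)

lemma cond_exp_commutant_idem:
  assumes "q \<in> commutant A" "q \<in> P" "x \<in> P" "q * q = q"
  shows "cond_exp P \<tau> A (q * x * q) = cond_exp P \<tau> A (q * x)"
  using cond_exp_commutant[of q "q * x"] assms by (simp add: mult_mem flip: mult.assoc)

end

section \<open>Unitary conjugation\<close>

text \<open>Conjugation by an invertible element is an automorphism of the whole operator ring, so
  it carries commutants to commutants; applied twice, it preserves the bicommutant property.\<close>

lemma commutant_conj:
  fixes u v :: "'h::complex_hilbert operator"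
  assumes uv: "u * v = 1" "v * u = 1"
  shows "commutant ((\<lambda>y. u * y * v) ` N) = (\<lambda>y. u * y * v) ` commutant N"
proof (intro equalityI subsetI)
  have [simp]: "u * (v * x) = x" "v * (u * x) = x" for x
    by (simp_all add: uv flip: mult.assoc)
  {
    fix a assume a: "a \<in> commutant ((\<lambda>y. u * y * v) ` N)"
    have "v * a * u * y = y * (v * a * u)" if "y \<in> N" for y
    proof -
      have "a * (u * y * v) = u * y * v * a" using a that by (simp add: commutant_def)
      then have "v * (a * (u * y * v)) * u = v * (u * y * v * a) * u" by simp
      then show ?thesis by (simp add: mult.assoc uv)
    qed
    then have "v * a * u \<in> commutant N" by (simp add: commutant_def)
    moreover have "a = u * (v * a * u) * v" by (simp add: mult.assoc uv)
    ultimately show "a \<in> (\<lambda>y. u * y * v) ` commutant N" by blast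
  next
    fix a assume "a \<in> (\<lambda>y. u * y * v) ` commutant N"
    then show "a \<in> commutant ((\<lambda>y. u * y * v) ` N)"
      by (auto simp: commutant_def mult.assoc) (simp flip: mult.assoc)
  }
qed

lemma von_neumann_algebra_conj:
  assumes "von_neumann_algebra M" "is_adjoint u v" "u * v = 1" "v * u = 1"
  shows "von_neumann_algebra ((\<lambda>y. u * y * v) ` M)"
  unfolding von_neumann_algebra_def
proof
  show "\<forall>a\<in>(\<lambda>y. u * y * v) ` M. \<exists>b\<in>(\<lambda>y. u * y * v) ` M. is_adjoint a b"
  proof
    fix a assume "a \<in> (\<lambda>y. u * y * v) ` M"
    then obtain y z where yz: "a = u * y * v" "z \<in> M" "is_adjoint y z"
      using assms(1) by (auto simp: von_neumann_algebra_def)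
    have "is_adjoint (u * y * v) (u * (z * v))"
      by (intro is_adjoint_mult yz assms is_adjoint_sym[of u v])
    then show "\<exists>b\<in>(\<lambda>y. u * y * v) ` M. is_adjoint a b"
      using yz by (auto simp: mult.assoc)
  qed
  show "commutant (commutant ((\<lambda>y. u * y * v) ` M)) = (\<lambda>y. u * y * v) ` M"
    using assms by (simp add: commutant_conj von_neumann_algebra_def)
qed

lemma finite_dim_conj:
  assumes "finite_dim M"
  shows "finite_dim ((\<lambda>y. u * y * (v :: 'h::complex_hilbert operator)) ` M)"
proof -
  have "module_hom scaleC scaleC (\<lambda>y. u * y * v)"
    by (intro module_hom.intro module_hom_axioms.intro cvec.module_axioms)
      (simp_all add: distrib_left distrib_right op_scaleC_mult_left op_scaleC_mult_right)
  then show ?thesis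
    using assms module_hom.span_image unfolding finite_dim_def by (metis finite_imageI)
qed

section \<open>The commutator relation and unitarity\<close>

text \<open>The two expressions for X stand in for self-adjointness, so the argument is pure ring
  algebra: p1 X is computed from one expression and p2 X from the other, and it remains to show X =
  p1 X + p2 X.\<close>

lemma commutator_identity:
  fixes p1 p2 q1 q2 :: "'a::ring"
  assumes "p1 * p1 = p1" "p2 * p2 = p2" "p1 * p2 = 0" "p2 * p1 = 0"
    and eq: "p1 * q1 + q2 * p2 = q1 * p1 + p2 * q2"
  shows "p1 * q1 + q2 * p2 = p1 * q1 * p1 + p2 * q2 * p2"
proof -
  define X where "X = p1 * q1 + q2 * p2"
  have kill: "p1 * (p2 * x) = 0" "p2 * (p1 * x) = 0" "p1 * (p1 * x) = p1 * x"
    "p2 * (p2 * x) = p2 * x" for x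
    using assms by (simp_all flip: mult.assoc)
  have 1: "p1 * X = p1 * q1 * p1"
    unfolding X_def eq by (simp add: distrib_left mult.assoc kill)
  have 2: "p2 * X = p2 * q2 * p2"
    unfolding X_def by (simp add: distrib_left mult.assoc kill)
  \<comment> \<open>Y = (1 - p1 - p2) X removes the leading p's. What survives of one expression for
    X ends in p2, giving Y p2 = Y; what survives of the other ends in p1, giving Y p2 = 0.\<close>
  define Y where "Y = X - p1 * X - p2 * X"
  have "Y = q2 * p2 - p1 * (q2 * p2) - p2 * (q2 * p2)"
    unfolding Y_def X_def by (simp add: algebra_simps kill)
  then have "Y * p2 = Y" by (simp add: left_diff_distrib mult.assoc assms)
  have "Y = q1 * p1 - p1 * (q1 * p1) - p2 * (q1 * p1)"
    unfolding Y_def X_def eq by (simp add: algebra_simps kill)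
  then have "Y * p2 = 0" by (simp add: left_diff_distrib mult.assoc assms)
  with \<open>Y * p2 = Y\<close> have "Y = 0" by simp
  then have "X = p1 * X + p2 * X" unfolding Y_def by (simp add: algebra_simps)
  then show ?thesis unfolding 1 2 by (simp add: X_def)
qed

lemma unimodular_conj_product:
  assumes "cmod l = 1"
  shows "(l - 1) * (cnj l - 1) = - ((l - 1) + (cnj l - 1))"
  using complex_norm_square[of l] assms by (simp add: algebra_simps)

text \<open>The c^2 and d^2 terms contain q1 q2 or q2 q1 and vanish. The coefficients of c, d and c
  d are the three expressions for X, so the product is 1 + (c + d + c d) X. With abstract scalars
  the statement is also available with p, q and c, d interchanged.\<close>

lemma twisted_product_eq_one:
  fixes p1 p2 q1 q2 :: "'h::complex_hilbert operator"
  assumes "p1 * p1 = p1" "p2 * p2 = p2" "p1 * p2 = 0" "p2 * p1 = 0"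
    "q1 * q1 = q1" "q2 * q2 = q2" "q1 * q2 = 0" "q2 * q1 = 0"
    and eq: "p1 * q1 + q2 * p2 = q1 * p1 + p2 * q2"
    and cd: "c * d = - (c + d)"
  shows "(1 + c *\<^sub>C (p1 * q1) + d *\<^sub>C (p2 * q2)) * (1 + d *\<^sub>C (q1 * p1) + c *\<^sub>C (q2 * p2)) = 1"
proof -
  define X where "X = p1 * q1 + q2 * p2"
  have X: "X = q1 * p1 + p2 * q2" "X = p1 * q1 * p1 + p2 * q2 * p2"
    unfolding X_def using eq commutator_identity[OF assms(1-4) eq] by simp_all
  have kill: "q1 * (q2 * x) = 0" "q2 * (q1 * x) = 0" "q1 * (q1 * x) = q1 * x"
    "q2 * (q2 * x) = q2 * x" for x
    using assms by (simp_all flip: mult.assoc)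
  have "(1 + c *\<^sub>C (p1 * q1) + d *\<^sub>C (p2 * q2)) * (1 + d *\<^sub>C (q1 * p1) + c *\<^sub>C (q2 * p2))
      = 1 + c *\<^sub>C (p1 * q1 + q2 * p2) + d *\<^sub>C (q1 * p1 + p2 * q2)
        + (c * d) *\<^sub>C (p1 * q1 * p1 + p2 * q2 * p2)"
    by (simp add: distrib_left distrib_right op_scaleC_mult_left op_scaleC_mult_right
        scaleC_scaleC scaleC_add_right mult.assoc kill mult.commute[of d c] add_ac)
  also have "\<dots> = 1 + (c + d + c * d) *\<^sub>C X"
    unfolding X_def[symmetric] X[symmetric] by (simp only: scaleC_add_left add.assoc)
  finally show ?thesis using cd by simp
qed

section \<open>Expectation of the rotated algebra and the commuting square\<close>

text \<open>Here A, B, N are P1, Q1, Q0. In every term of the expansion the q's stand next to y, so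
  together they form an element of \<open>N\<close>, where E_A agrees with E_B; the p's stand
  outside and are pulled out of E_A by the bimodule rule.\<close>

lemma cond_exp_twisted_conj:
  fixes P :: "'h::complex_hilbert operator set"
  assumes "tracial_subalgebra P \<tau> A" "tracial_subalgebra P \<tau> B" "B \<subseteq> A"
    and commuting: "\<And>y. y \<in> N \<Longrightarrow> cond_exp P \<tau> A y = cond_exp P \<tau> B y"
    and N: "von_neumann_algebra N" "N \<subseteq> P"
    and p: "p1 \<in> A" "p2 \<in> A" "p1 \<in> commutant B" "p2 \<in> commutant B" "p1 * p2 = 0" "p2 * p1 = 0"
      "p1 * p1 = p1" "p2 * p2 = p2"
    and q: "q1 \<in> N" "q2 \<in> N" "q1 \<in> commutant B" "q2 \<in> commutant B" "q1 * q1 = q1" "q2 * q2 = q2"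
    and cd: "c * d = - (c + d)"
    and y: "y \<in> N"
  shows "cond_exp P \<tau> A ((1 + c *\<^sub>C (p1 * q1) + d *\<^sub>C (p2 * q2)) * y *
      (1 + d *\<^sub>C (q1 * p1) + c *\<^sub>C (q2 * p2))) = cond_exp P \<tau> B y"
proof -
  interpret A: tracial_subalgebra P \<tau> A by fact
  interpret B: tracial_subalgebra P \<tau> B by fact
  interpret N: vn_algebra N by (rule vn_algebra.intro) fact
  define e where "e = cond_exp P \<tau> A"
  define f where "f = cond_exp P \<tau> B"
  have NP: "x \<in> P" if "x \<in> N" for x using that N(2) by auto
  have AP: "x \<in> P" if "x \<in> A" for x using that A.subset by auto
  have pf: "f x * p1 = p1 * f x" "f x * p2 = p2 * f x" if "x \<in> P" for x
    using p(3,4) B.cond_exp_mem[OF that] by (auto simp: commutant_def f_def)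
  have e_sandwich: "e (a * x * b) = a * f x * b" if "x \<in> N" "a \<in> A" "b \<in> A" for a x b
    using A.cond_exp_bimodule[OF that(2,3) NP[OF that(1)]] commuting[OF that(1)]
    by (simp add: e_def f_def)
  have e_left: "e (a * x) = a * f x" if "x \<in> N" "a \<in> A" for a x
    using A.cond_exp_left[OF that(2) NP[OF that(1)]] commuting[OF that(1)]
    by (simp add: e_def f_def)
  have e_right: "e (x * a) = f x * a" if "x \<in> N" "a \<in> A" for a x
    using A.cond_exp_right[OF that(2) NP[OF that(1)]] commuting[OF that(1)]
    by (simp add: e_def f_def)
  have f1: "f (y * q1) = f (q1 * y)" "f (q1 * y * q1) = f (q1 * y)"
    using q y B.cond_exp_commutant[of q1 y] B.cond_exp_commutant_idem[of q1 y] NP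
    by (simp_all add: f_def)
  have f2: "f (y * q2) = f (q2 * y)" "f (q2 * y * q2) = f (q2 * y)"
    using q y B.cond_exp_commutant[of q2 y] B.cond_exp_commutant_idem[of q2 y] NP
    by (simp_all add: f_def)
  \<comment> \<open>Values of \<open>f\<close> lie in \<open>B\<close>, which commutes with the p's.
    Both p's can thus be brought together, which kills the mixed c^2 and d^2 terms and shortens the
    others.\<close>
  have zero: "p1 * f x * p2 = 0" "p2 * f x * p1 = 0" if "x \<in> P" for x
    using p(5,6) by (simp_all add: mult.assoc pf[OF that]) (simp_all flip: mult.assoc)
  have idem: "p1 * f x * p1 = p1 * f x" "p2 * f x * p2 = p2 * f x" if "x \<in> P" for x
    using p(7,8) by (simp_all add: mult.assoc pf[OF that]) (simp_all flip: mult.assoc)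
  have expand: "(1 + c *\<^sub>C (p1 * q1) + d *\<^sub>C (p2 * q2)) * y * (1 + d *\<^sub>C (q1 * p1) + c *\<^sub>C (q2 * p2))
    = y + c *\<^sub>C (p1 * (q1 * y)) + d *\<^sub>C (p2 * (q2 * y))
      + d *\<^sub>C (y * q1 * p1) + c *\<^sub>C (y * q2 * p2)
      + (c * d) *\<^sub>C (p1 * (q1 * y * q1) * p1) + (c * d) *\<^sub>C (p2 * (q2 * y * q2) * p2)
      + (c * c) *\<^sub>C (p1 * (q1 * y * q2) * p2) + (d * d) *\<^sub>C (p2 * (q2 * y * q1) * p1)"
    by (simp add: distrib_left distrib_right op_scaleC_mult_left op_scaleC_mult_right
        scaleC_scaleC scaleC_add_right mult.assoc mult.commute[of d c] add_ac)
  have e_linear: "e (x + z) = e x + e z" "e (k *\<^sub>C x) = k *\<^sub>C e x" if "x \<in> P" "z \<in> P" for x z k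
    using that by (auto simp: e_def A.cond_exp_add A.cond_exp_scaleC)
  have inP: "p1 * (q1 * y) \<in> P" "p2 * (q2 * y) \<in> P" "y * q1 * p1 \<in> P" "y * q2 * p2 \<in> P"
    "p1 * (q1 * y * q1) * p1 \<in> P" "p2 * (q2 * y * q2) * p2 \<in> P"
    "p1 * (q1 * y * q2) * p2 \<in> P" "p2 * (q2 * y * q1) * p1 \<in> P" "y \<in> P"
    using y p(1,2) q(1,2) by (auto intro!: A.mult_mem intro: NP AP)
  have "e ((1 + c *\<^sub>C (p1 * q1) + d *\<^sub>C (p2 * q2)) * y * (1 + d *\<^sub>C (q1 * p1) + c *\<^sub>C (q2 * p2)))
    = e y + c *\<^sub>C e (p1 * (q1 * y)) + d *\<^sub>C e (p2 * (q2 * y))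
      + d *\<^sub>C e (y * q1 * p1) + c *\<^sub>C e (y * q2 * p2)
      + (c * d) *\<^sub>C e (p1 * (q1 * y * q1) * p1) + (c * d) *\<^sub>C e (p2 * (q2 * y * q2) * p2)
      + (c * c) *\<^sub>C e (p1 * (q1 * y * q2) * p2) + (d * d) *\<^sub>C e (p2 * (q2 * y * q1) * p1)"
    unfolding expand using inP by (simp add: e_linear A.add_mem A.scale_mem)
  \<comment> \<open>Each of p1 f(q1 y) and p2 f(q2 y) now occurs three times: from the left factor,
    from the right factor and from both, with coefficients c, d and c d in some order.\<close>
  also have "\<dots> = f y + c *\<^sub>C (p1 * f (q1 * y)) + d *\<^sub>C (p2 * f (q2 * y))
      + d *\<^sub>C (p1 * f (q1 * y)) + c *\<^sub>C (p2 * f (q2 * y))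
      + (c * d) *\<^sub>C (p1 * f (q1 * y)) + (c * d) *\<^sub>C (p2 * f (q2 * y))"
    using y p(1,2) q(1,2)
    by (simp add: e_left e_right e_sandwich N.mult_mem NP f1 f2 zero idem pf)
      (simp add: e_def f_def commuting)
  also have "\<dots> = f y + (c + d + c * d) *\<^sub>C (p1 * f (q1 * y)) + (c + d + c * d) *\<^sub>C (p2 * f (q2 * y))"
    by (simp only: scaleC_add_left add_ac)
  also have "\<dots> = f y" using cd by simp
  finally show ?thesis by (simp add: e_def f_def)
qed

text \<open>The fourth corner is U Q0 U^*, with U on the left: the order in which the q's meet Q0
  and the p's stand outside, as \<open>cond_exp_twisted_conj\<close> requires.\<close>

theorem theorem4p2:
  fixes P1 P0 Q1 Q0 :: "'h::complex_hilbert operator set"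
    and \<tau> :: "'h operator \<Rightarrow> complex"
    and p1 p2 q1 q2 :: "'h operator"
    and U :: "complex \<Rightarrow> 'h operator"
  assumes "commuting_square P1 P0 Q1 Q0 \<tau>"
    and "projection p1" "projection p2" "p1 * p2 = 0"
    and "{p1, p2} \<subseteq> commutant Q1 \<inter> P1"
    and "projection q1" "projection q2" "q1 * q2 = 0"
    and "{q1, q2} \<subseteq> commutant Q1 \<inter> Q0"
    and "p1 \<notin> Q1" "p2 \<notin> Q1" "q1 \<notin> Q1" "q2 \<notin> Q1"
    and "commutator p1 q1 - commutator p2 q2 = 0"
    and "\<And>l. U l = 1 + (l - 1) *\<^sub>C (p1 * q1) + (cnj l - 1) *\<^sub>C (p2 * q2)"
  shows "\<forall>l. cmod l = 1 \<longrightarrow> commuting_square P1 P0 Q1 ((\<lambda>y. U l * y * adj (U l)) ` Q0) \<tau>"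
proof (intro allI impI)
  fix l :: complex
  assume l: "cmod l = 1"
  have square: "von_neumann_algebra P1" "von_neumann_algebra P0" "von_neumann_algebra Q1"
    "von_neumann_algebra Q0" "finite_dim P1" "finite_dim P0" "finite_dim Q1" "finite_dim Q0"
    "Q1 \<subseteq> P1" "P1 \<subseteq> P0" "Q1 \<subseteq> Q0" "Q0 \<subseteq> P0" "faithful_normalized_trace P0 \<tau>"
    "\<And>x. x \<in> P0 \<Longrightarrow> cond_exp P0 \<tau> P1 (cond_exp P0 \<tau> Q0 x) = cond_exp P0 \<tau> Q1 x"
    using assms(1) unfolding commuting_square_def by auto
  have subalgebra: "tracial_subalgebra P0 \<tau> A"
    if "von_neumann_algebra A" "finite_dim A" "A \<subseteq> P0" for A
    using that square by unfold_locales
  interpret E1: tracial_subalgebra P0 \<tau> P1 using square by (intro subalgebra)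
  interpret E0: tracial_subalgebra P0 \<tau> Q0 using square by (intro subalgebra)
  interpret F1: tracial_subalgebra P0 \<tau> Q1 using square by (intro subalgebra) auto
  have mem: "p1 \<in> P1" "p2 \<in> P1" "q1 \<in> Q0" "q2 \<in> Q0" "p1 \<in> commutant Q1" "p2 \<in> commutant Q1"
    "q1 \<in> commutant Q1" "q2 \<in> commutant Q1"
    using assms(5,9) by auto
  then have memP: "p1 \<in> P0" "p2 \<in> P0" "q1 \<in> P0" "q2 \<in> P0"
    using square by auto
  have p: "adj p1 = p1" "adj p2 = p2" "p1 * p1 = p1" "p2 * p2 = p2"
    and q: "adj q1 = q1" "adj q2 = q2" "q1 * q1 = q1" "q2 * q2 = q2"
    using assms(2,3,6,7) by (auto simp: projection_def)
  \<comment> \<open>Adjoints of p1 p2 = 0 and q1 q2 = 0.\<close>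
  have p21: "p2 * p1 = 0" and q21: "q2 * q1 = 0"
    using E1.adj_mult[of p1 p2] E1.adj_mult[of q1 q2] assms(4,8) memP p q
    by (simp_all add: adj_zero)
  have eq: "p1 * q1 + q2 * p2 = q1 * p1 + p2 * q2"
    using assms(14) by (simp add: commutator_def algebra_simps)
  define c where "c = l - 1"
  define d where "d = cnj l - 1"
  have cd: "c * d = - (c + d)" "d * c = - (d + c)"
    using unimodular_conj_product[OF l] by (simp_all add: c_def d_def mult.commute)
  define u where "u = 1 + c *\<^sub>C (p1 * q1) + d *\<^sub>C (p2 * q2)"
  define v where "v = 1 + d *\<^sub>C (q1 * p1) + c *\<^sub>C (q2 * p2)"
  have u: "U l = u" by (simp add: assms(15) u_def c_def d_def)
  have uP: "u \<in> P0" and vP: "v \<in> P0"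
    unfolding u_def v_def
    by (intro E1.add_mem E1.one_mem E1.scale_mem E1.mult_mem memP)+
  have v: "adj u = v"
    unfolding u_def v_def
    by (simp add: E1.adj_add E1.adj_scaleC E1.adj_mult E1.add_mem E1.one_mem E1.scale_mem
        E1.mult_mem memP p q adj_one c_def d_def)
  have adjoint: "is_adjoint u v" using E1.is_adjoint_mem[OF uP] v by simp
  have uv: "u * v = 1"
    unfolding u_def v_def using assms(4,8) by (intro twisted_product_eq_one p q p21 q21 eq cd)
  \<comment> \<open>Interchanging p with q and c with d turns u v into v u, and the relation is
    symmetric under this exchange.\<close>
  have "q1 * p1 + p2 * q2 = p1 * q1 + q2 * p2" using eq by simp
  then have vu: "v * u = 1"
    unfolding u_def v_def using assms(4,8) by (intro twisted_product_eq_one p q p21 q21 cd)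
  let ?N = "(\<lambda>y. u * y * v) ` Q0"
  have N: "von_neumann_algebra ?N" "finite_dim ?N"
    using square adjoint uv vu by (simp_all add: von_neumann_algebra_conj finite_dim_conj)
  have NP: "?N \<subseteq> P0" using uP vP square(12) by (auto intro!: E1.mult_mem)
  interpret N: tracial_subalgebra P0 \<tau> ?N using N NP by (rule subalgebra)
  have QN: "Q1 \<subseteq> ?N"
  proof
    fix x assume x: "x \<in> Q1"
    \<comment> \<open>Both p's and q's commute with Q1, hence so does \<open>u\<close>; conjugation
      therefore fixes Q1 pointwise.\<close>
    have "p1 * (q1 * x) = x * (p1 * q1)" "p2 * (q2 * x) = x * (p2 * q2)"
      using mem(5-8) x by (auto simp: commutant_def) (metis mult.assoc)+
    then have "u * x = x * u"
      by (simp add: u_def distrib_left distrib_right op_scaleC_mult_left op_scaleC_mult_right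
          mult.assoc)
    then have "x = u * x * v" by (simp add: mult.assoc uv)
    then show "x \<in> ?N" using x square(11) by blast
  qed
  \<comment> \<open>E_Q0 is the identity on Q0, so there the original square says that E_P1 and E_Q1
    coincide.\<close>
  have restricted: "cond_exp P0 \<tau> P1 y = cond_exp P0 \<tau> Q1 y" if "y \<in> Q0" for y
    using square(14)[of y] E0.cond_exp_id[OF that] that square(12) by auto
  have conj: "cond_exp P0 \<tau> P1 (u * y * v) = cond_exp P0 \<tau> Q1 y" if "y \<in> Q0" for y
    unfolding u_def v_def
    by (rule cond_exp_twisted_conj[where N = Q0])
      (use E1.tracial_subalgebra_axioms F1.tracial_subalgebra_axioms restricted square mem
        assms(4) p21 p q cd that in auto)
  have "cond_exp P0 \<tau> P1 (cond_exp P0 \<tau> ?N x) = cond_exp P0 \<tau> Q1 x" if x: "x \<in> P0" for x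
  proof -
    let ?z = "cond_exp P0 \<tau> ?N x"
    have z: "?z \<in> ?N" using x by (rule N.cond_exp_mem)
    then have zP: "?z \<in> P0" using NP by blast
    \<comment> \<open>E_P1(z) lies in Q1 by \<open>conj\<close>, so it is E_Q1(x) once its traces
      against Q1 are those of x. Each of the two expectations preserves them, as Q1 lies in both P1
      and the rotated algebra.\<close>
    show ?thesis
    proof (rule F1.cond_exp_eqI[symmetric, OF x])
      show "cond_exp P0 \<tau> P1 ?z \<in> Q1"
        using z conj F1.cond_exp_mem square(12) by auto
      fix b assume b: "b \<in> Q1"
      have "\<tau> (b * cond_exp P0 \<tau> P1 ?z) = \<tau> (b * ?z)"
        using b square(9) zP by (intro E1.trace_mult_cond_exp) auto
      also have "\<dots> = \<tau> (b * x)"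
        using b QN x by (intro N.trace_mult_cond_exp) auto
      finally show "\<tau> (b * x) = \<tau> (b * cond_exp P0 \<tau> P1 ?z)" ..
    qed
  qed
  then show "commuting_square P1 P0 Q1 ((\<lambda>y. U l * y * adj (U l)) ` Q0) \<tau>"
    unfolding commuting_square_def u v using square N NP QN by auto
qed

end
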